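(* Let $n>1$ be an integer and let $q=3^n$. For $a\in\mathbb{F}_q^\times$, say that $a$ satisfies condition (E) if $a$ is a square in $\mathbb{F}_q$ and $\operatorname{Tr}(\sqrt a)\neq0$, and that $a$ satisfies condition (O) if either $a$ is a non-square in $\mathbb{F}_q$, or $a$ is a square and $\operatorname{Tr}(\sqrt a)=0$. Here $\sqrt a$ denotes any $b\in\mathbb{F}_q$ with $b^2=a$. Then for every $a\in\mathbb{F}_q^\times$ the ternary Kloosterman sum $\mathcal{K}_q(a)$ satisfies \[ \mathcal{K}_q(a)\equiv\begin{cases} 0\pmod{18} & \text{if } \operatorname{Tr}(a)=0 \text{ and (E) holds},\\ 3\pmod{18} & \text{if } \operatorname{Tr}(a)=1 \text{ and (O) holds},\\ 6\pmod{18} & \text{if } \operatorname{Tr}(a)=2 \text{ and (E) holds},\\ 9\pmod{18} & \text{if } \operatorname{Tr}(a)=0 \text{ and (O) holds},\\ 12\pmod{18} & \text{if } \operatorname{Tr}(a)=1 \text{ and (E) holds},\\ 15\pmod{18} & \text{if } \operatorname{Tr}(a)=2 \text{ and (O) holds}. \end{cases} \]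
   Context: For $q=3^n$, $\operatorname{Tr}:\mathbb{F}_q\to\mathbb{F}_3$ is the absolute trace $\operatorname{Tr}(c)=c+c^3+c^{3^2}+\cdots+c^{3^{n-1}}$. With $\zeta$ a primitive cube root of unity, the ternary Kloosterman sum is \[\mathcal{K}_q(a)=\sum_{x\in\mathbb{F}_q}\zeta^{\operatorname{Tr}(x^{q-2}+ax)},\] where the sum includes $x=0$ (so $x^{q-2}=x^{-1}$ for $x\neq0$ and $0^{q-2}=0$). It is a rational integer, independent of the choice of $\zeta$. The condition $\operatorname{Tr}(\sqrt a)\ne 0$ does not depend on the choice of square root. *)

theory Defs
  imports Complex_Main
    "HOL-Library.Cardinality"
    "HOL-Computational_Algebra.Nth_Powers"
    "HOL-Number_Theory.Number_Theory"
begin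

text \<open>
  The absolute trace of the field with \<open>3 ^ n\<close> elements. Its values lie in the prime field, which is
  kept as the subset \<open>{0, 1, 2}\<close> of the type \<open>'a\<close>.
\<close>

definition abs_trace :: "nat \<Rightarrow> 'a::field \<Rightarrow> 'a" where
  "abs_trace n c = (\<Sum>i<n. c ^ (3 ^ i))"

text \<open>
  To be used as an exponent, an element of the prime field is replaced by its representative
  in \<open>{0, 1, 2}\<close>; the value on all other elements is irrelevant.
\<close>

definition F3_rep :: "'a::field \<Rightarrow> nat" where
  "F3_rep t = (THE k. k < 3 \<and> of_nat k = t)"

lemma F3_rep_of_nat:
  assumes "CHAR('a::field) = 3" "k < 3"
  shows "F3_rep (of_nat k :: 'a) = k"
  unfolding F3_rep_def
proof (rule the_equality)
  fix j assume "j < 3 \<and> of_nat j = (of_nat k :: 'a)"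
  then show "j = k"
    using assms of_nat_eq_iff_cong_CHAR[where 'a = 'a, of j k] by (auto simp: cong_def)
qed (use assms in simp)

definition primitive_cube_root :: "complex \<Rightarrow> bool" where
  "primitive_cube_root \<zeta> \<longleftrightarrow> \<zeta> ^ 3 = 1 \<and> (\<forall>k. 0 < k \<and> k < 3 \<longrightarrow> \<zeta> ^ k \<noteq> 1)"

definition kloosterman_sum :: "nat \<Rightarrow> complex \<Rightarrow> 'a::finite_field \<Rightarrow> complex" where
  "kloosterman_sum n \<zeta> a = (\<Sum>x\<in>UNIV. \<zeta> ^ F3_rep (abs_trace n (x ^ (3 ^ n - 2) + a * x)))"

text \<open>
  Both conditions below are insensitive to the choice of the square root \<open>b\<close>, since
  \<open>abs_trace n (- b) = - abs_trace n b\<close>.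
\<close>

definition condition_E :: "nat \<Rightarrow> 'a::finite_field \<Rightarrow> bool" where
  "condition_E n a \<longleftrightarrow> (\<exists>b. b ^ 2 = a \<and> abs_trace n b \<noteq> 0)"

definition condition_O :: "nat \<Rightarrow> 'a::finite_field \<Rightarrow> bool" where
  "condition_O n a \<longleftrightarrow> \<not> is_square a \<or> (\<exists>b. b ^ 2 = a \<and> abs_trace n b = 0)"

end

theory Submission
  imports Defs "HOL-Library.Disjoint_Sets" "HOL-Library.Z2" "HOL-Computational_Algebra.Polynomial"
begin

text \<open>
  Write \<open>q = 3 ^ n\<close>, let \<open>T x\<close> be the trace of \<open>inverse x + a * x\<close> (with \<open>inverse 0 = 0\<close>), and
  let \<open>N\<close> be the number of \<open>x\<close> with \<open>T x = 1\<close>. Because \<open>T\<close> is odd, as many \<open>x\<close>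
  satisfy \<open>T x = 2\<close>, and \<open>\<zeta> + \<zeta> ^ 2 = - 1\<close> shows that the Kloosterman sum is the integer
  \<open>q - 3 * N\<close> (\<open>kloosterman_sum_eq\<close>). The residue of this number modulo \<open>18\<close> is determined by
  its residues modulo \<open>9\<close> and modulo \<open>2\<close>. As \<open>9\<close> divides \<open>q\<close> and \<open>q\<close> is odd, these
  depend only on \<open>N\<close> modulo \<open>3\<close> and on the parity of \<open>N\<close>.

  Modulo \<open>3\<close>, the count \<open>N\<close> can be computed inside the field, as the sum
  of \<open>- (T x ^ 2 + T x)\<close> over all \<open>x\<close>. Writing the trace as a sum of powers with exponents
  \<open>3 ^ i\<close> reduces this to power sums over the field, almost all of which vanish. The result is that
  \<open>N\<close> equals \<open>- abs_trace n a\<close> in the field (\<open>of_nat_trace_one_count\<close>), so that the Kloosterman sum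
  is \<open>3\<close> times the trace of \<open>a\<close> modulo \<open>9\<close>.

  Modulo \<open>2\<close>, the involution \<open>x \<mapsto> inverse (a * x)\<close> preserves \<open>T\<close>, so only its fixed points
  count. They are the inverses of the square roots of \<open>a\<close>, and \<open>N\<close> is odd exactly if these
  square roots exist and have nonzero trace (\<open>odd_trace_one_count_iff\<close>).
\<close>

section \<open>Counting with involutions\<close>

text \<open>
  The points that are moved by the involution fall into pairs. Summing \<open>1\<close> over them in the field
  with two elements turns this pairing into a vanishing sum.
\<close>

lemma even_card_iff_even_card_fixpoints:
  assumes "finite A" and h: "\<And>x. x \<in> A \<Longrightarrow> h x \<in> A" "\<And>x. x \<in> A \<Longrightarrow> h (h x) = x"
  shows "even (card A) \<longleftrightarrow> even (card {x\<in>A. h x = x})"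
proof -
  define B where "B = {x\<in>A. h x \<noteq> x}"
  have "(\<Sum>x\<in>B. (1::bit)) = 0"
  proof (rule sum_involution_eq_0)
    show "(1::bit) + 1 = 0"
      by simp
    show "h x \<in> B" "h (h x) = x" "h x \<noteq> x" if "x \<in> B" for x
      using that h[of x] by (auto simp: B_def)
  qed
  then have "of_nat (card B) = (0::bit)"
    by (simp only: sum_constant mult_1_right)
  then have "even (card B)"
    by (metis even_of_nat even_zero)
  moreover have "card A = card B + card {x\<in>A. h x = x}"
  proof -
    have "A = B \<union> {x\<in>A. h x = x}" "B \<inter> {x\<in>A. h x = x} = {}"
      by (auto simp: B_def)
    moreover have "finite B" "finite {x\<in>A. h x = x}"
      using \<open>finite A\<close> by (auto simp: B_def)
    ultimately show ?thesis
      using card_Un_disjoint by metis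
  qed
  ultimately show ?thesis
    by simp
qed

section \<open>Power sums over a finite field\<close>

text \<open>
  The usual proof that a nontrivial character sums to zero: the substitution \<open>x \<mapsto> c * x\<close> multiplies
  the sum by \<open>f c\<close>.
\<close>

lemma sum_multiplicative_eq_0:
  fixes f :: "'a::finite_field \<Rightarrow> 'b::idom"
  assumes mult: "\<And>x. f (c * x) = f c * f x" and "c \<noteq> 0" "f c \<noteq> 1"
  shows "(\<Sum>x\<in>UNIV. f x) = 0"
proof -
  have "(\<Sum>x\<in>UNIV. f x) = (\<Sum>x\<in>UNIV. f (c * x))"
    by (rule sum.reindex_bij_witness[of _ "\<lambda>x. c * x" "\<lambda>x. x / c"]) (use \<open>c \<noteq> 0\<close> in auto)
  also have "\<dots> = f c * (\<Sum>x\<in>UNIV. f x)"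
    by (simp add: mult sum_distrib_left)
  finally show ?thesis
    using \<open>f c \<noteq> 1\<close> by simp
qed

text \<open>
  Otherwise the nonzero polynomial \<open>X ^ k - X ^ m\<close> would vanish at all nonzero elements, which are
  more numerous than its degree allows.
\<close>

lemma exists_power_neq_power:
  assumes "k \<noteq> m" "k < CARD('a::finite_field) - 1" "m < CARD('a) - 1"
  shows "\<exists>c::'a. c \<noteq> 0 \<and> c ^ k \<noteq> c ^ m"
proof (rule ccontr)
  assume "\<not> ?thesis"
  then have eq: "c ^ k = c ^ m" if "c \<noteq> 0" for c :: 'a
    using that by blast
  define p :: "'a poly" where "p = monom 1 k - monom 1 m"
  have "coeff p k = 1"
    using assms by (simp add: p_def)
  then have "p \<noteq> 0"
    by auto
  have "CARD('a) - 1 = card (UNIV - {0::'a})"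
    by simp
  also have "\<dots> \<le> card {x. poly p x = 0}"
    by (rule card_mono) (auto simp: p_def poly_monom eq)
  also have "\<dots> \<le> degree p"
    by (rule card_poly_roots_bound) fact
  also have "\<dots> \<le> max k m"
    unfolding p_def by (rule degree_diff_le_max[THEN order_trans]) (auto simp: degree_monom_eq)
  finally show False
    using assms by simp
qed

lemma sum_power_eq_0:
  assumes "0 < k" "k < CARD('a::finite_field) - 1"
  shows "(\<Sum>x\<in>UNIV. (x::'a) ^ k) = 0"
proof -
  have "\<exists>c::'a. c \<noteq> 0 \<and> c ^ k \<noteq> c ^ 0"
    by (rule exists_power_neq_power) (use assms in auto)
  then obtain c :: 'a where "c \<noteq> 0" "c ^ k \<noteq> c ^ 0"
    by blast
  then show ?thesis
    by (intro sum_multiplicative_eq_0[where c = c]) (auto simp: power_mult_distrib)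
qed

text \<open>
  Orthogonality of the characters \<open>x \<mapsto> x ^ k\<close> of the multiplicative group. On the diagonal,
  the sum counts the nonzero elements, and their number is \<open>-1\<close> in the field; the
  hypothesis \<open>0 < k\<close> removes the term of \<open>x = 0\<close>.
\<close>

lemma sum_inverse_power_times_power:
  assumes "0 < k" "k < CARD('a::finite_field) - 1" "m < CARD('a) - 1"
  shows "(\<Sum>x\<in>UNIV. inverse (x::'a) ^ k * x ^ m) = (if k = m then -1 else 0)"
proof (cases "k = m")
  case True
  have "(\<Sum>x\<in>UNIV. inverse (x::'a) ^ k * x ^ m) = (\<Sum>x\<in>UNIV - {0::'a}. 1)"
    using assms(1) True
    by (intro sum.mono_neutral_cong_right) (auto simp flip: power_mult_distrib)
  also have "\<dots> = of_nat (CARD('a) - 1)"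
    by simp
  also have "\<dots> = of_nat (CARD('a)) - 1"
    by (subst of_nat_diff) (auto simp: Suc_le_eq)
  also have "(of_nat (CARD('a)) :: 'a) = 0"
    using CHAR_dvd_CARD of_nat_eq_0_iff_char_dvd by blast
  finally show ?thesis
    using True by simp
next
  case False
  then obtain c :: 'a where c: "c \<noteq> 0" "c ^ k \<noteq> c ^ m"
    using exists_power_neq_power[where 'a = 'a and k = k and m = m] assms by auto
  then have "inverse c ^ k * c ^ m \<noteq> 1"
    by (auto simp: field_simps)
  then have "(\<Sum>x\<in>UNIV. inverse (x::'a) ^ k * x ^ m) = 0"
    using c by (intro sum_multiplicative_eq_0[where c = c]) (auto simp: power_mult_distrib)
  then show ?thesis
    using False by simp
qed

section \<open>The trace of a field with 3^n elements\<close>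

lemma CHAR_eq_3:
  assumes "CARD('a::finite_field) = 3 ^ n"
  shows "CHAR('a) = 3"
proof -
  have "CHAR('a) dvd 3 ^ n"
    using CHAR_dvd_CARD[where 'a = 'a] assms by simp
  then have "CHAR('a) dvd 3"
    using prime_dvd_power CHAR_prime by blast
  then show ?thesis
    using CHAR_prime[where 'a = 'a] primes_dvd_imp_eq[of "CHAR('a)" 3] by simp
qed

lemma two_eq_minus_one:
  assumes "CHAR('a::comm_ring_1) = 3"
  shows "(2::'a) = - 1"
proof -
  have "(3::'a) = 0"
    using of_nat_CHAR[where 'a = 'a] assms by simp
  then show ?thesis
    by (simp add: eq_neg_iff_add_eq_0)
qed

lemma abs_trace_add:
  assumes "CHAR('a::finite_field) = 3"
  shows "abs_trace n (x + y :: 'a) = abs_trace n x + abs_trace n y"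
  using CHAR_prime[where 'a = 'a] assms
  by (simp add: abs_trace_def freshmans_dream' sum.distrib)

lemma abs_trace_uminus: "abs_trace n (- x) = - abs_trace n x"
  by (simp add: abs_trace_def sum_negf)

lemma abs_trace_eq_0_cong_square:
  assumes "b ^ 2 = (c :: 'a::field) ^ 2"
  shows "abs_trace n b = 0 \<longleftrightarrow> abs_trace n c = 0"
proof -
  have "b = c \<or> b = - c"
    using assms by (simp only: power2_eq_iff)
  then show ?thesis
    by (elim disjE) (simp_all add: abs_trace_uminus)
qed

text \<open>
  Turns the exponent of the Kloosterman sum into one with a genuine inverse, with the value \<open>0\<close> at
  \<open>0\<close> on both sides.
\<close>

lemma inverse_eq_power:
  assumes "CARD('a::finite_field) > 2"
  shows "(x::'a) ^ (CARD('a) - 2) = inverse x"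
proof (cases "x = 0")
  case False
  have "x ^ (CARD('a) - 2) * x * x = x ^ CARD('a)"
    using assms by (simp flip: power_Suc2 add: numeral_2_eq_2 Suc_diff_Suc)
  also have "\<dots> = x"
    by (rule finite_field_power_card_eq_same)
  finally show ?thesis
    using False by (simp add: field_simps)
qed (use assms in simp)

text \<open>
  Cubing permutes the conjugates of \<open>c\<close> cyclically, so the trace is a root of \<open>X ^ 3 - X\<close>, which
  splits as \<open>X * (X - 1) * (X - 2)\<close> in characteristic \<open>3\<close>.
\<close>

lemma abs_trace_cases:
  assumes "CARD('a::finite_field) = 3 ^ n"
  shows "abs_trace n (c::'a) \<in> {0, 1, 2}"
proof -
  define t where "t = abs_trace n c"
  have char: "CHAR('a) = 3"
    by (rule CHAR_eq_3) fact
  have three: "(3::'a) = 0"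
    using char of_nat_CHAR[where 'a = 'a] by simp
  have "t ^ 3 = (\<Sum>i<n. c ^ (3 ^ Suc i))"
    using CHAR_prime[where 'a = 'a] char
    by (simp add: t_def abs_trace_def freshmans_dream_sum mult.commute flip: power_mult)
  also have "\<dots> + c = t + c ^ (3 ^ n)"
    using sum.lessThan_Suc_shift[of "\<lambda>i. c ^ (3 ^ i)" n]
    by (simp add: t_def abs_trace_def add.commute)
  also have "c ^ (3 ^ n) = c"
    using finite_field_power_card_eq_same[of c] assms by simp
  finally have "t ^ 3 = t"
    by simp
  moreover have "t * (t - 1) * (t - 2) = t ^ 3 - t - 3 * (t ^ 2 - t)"
    by (simp add: algebra_simps power2_eq_square power3_eq_cube)
  ultimately have "t * (t - 1) * (t - 2) = 0"
    using three by simp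
  then show ?thesis
    unfolding t_def by auto
qed

section \<open>The exponent of the Kloosterman sum\<close>

definition kloosterman_trace :: "nat \<Rightarrow> 'a::finite_field \<Rightarrow> 'a \<Rightarrow> 'a" where
  "kloosterman_trace n a x = abs_trace n (inverse x + a * x)"

definition trace_one_count :: "nat \<Rightarrow> 'a::finite_field \<Rightarrow> nat" where
  "trace_one_count n a = card {x. kloosterman_trace n a x = 1}"

text \<open>
  The exponents that occur in the square of a trace lie below the order of the multiplicative group.
  For \<open>n = 1\<close> this fails, and the power sum of exponent \<open>3 ^ 0 + 3 ^ 0 = 3 - 1\<close> does not vanish.
\<close>

lemma two_times_power_3_less:
  assumes "n > (1::nat)" "i < n" "j < n"
  shows "3 ^ i + 3 ^ j < (3::nat) ^ n - 1"
proof -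
  have "(3::nat) ^ i \<le> 3 ^ (n - 1)" "(3::nat) ^ j \<le> 3 ^ (n - 1)"
    using assms by (auto intro!: power_increasing)
  moreover have "3 \<le> (3::nat) ^ (n - 1)"
    using assms by (intro self_le_power) auto
  moreover have "(3::nat) ^ n = 3 * 3 ^ (n - 1)"
    using assms by (simp flip: power_Suc)
  ultimately show ?thesis
    by linarith
qed

lemma sum_abs_trace_squared:
  assumes "n > 1" "CARD('a::finite_field) = 3 ^ n"
  shows "(\<Sum>x\<in>UNIV. abs_trace n (x::'a) ^ 2) = 0"
proof -
  have "(\<Sum>x\<in>UNIV. abs_trace n (x::'a) ^ 2) =
        (\<Sum>i<n. \<Sum>j<n. \<Sum>x\<in>UNIV. (x::'a) ^ (3 ^ i + 3 ^ j))"
    unfolding power2_eq_square abs_trace_def sum_product power_add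
    by (subst sum.swap, intro sum.cong refl, subst sum.swap, rule refl)
  also have "\<dots> = 0"
    using two_times_power_3_less assms by (intro sum.neutral ballI sum_power_eq_0) auto
  finally show ?thesis .
qed

text \<open>
  Of the products of a conjugate of \<open>inverse x\<close> and a conjugate of \<open>a * x\<close>, only those with
  matching conjugations survive the summation, and each of them contributes a
  conjugate of \<open>- a\<close>.
\<close>

lemma sum_abs_trace_inverse_times_abs_trace:
  assumes "n > 1" "CARD('a::finite_field) = 3 ^ n"
  shows "(\<Sum>x\<in>UNIV. abs_trace n (inverse x) * abs_trace n (a * x)) = - abs_trace n (a::'a)"
proof -
  have less: "(3::nat) ^ i < CARD('a) - 1" if "i < n" for i
    using two_times_power_3_less[of n i i] that assms by simp
  have "(\<Sum>x\<in>UNIV. abs_trace n (inverse x) * abs_trace n (a * x)) =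
        (\<Sum>i<n. \<Sum>j<n. \<Sum>x\<in>UNIV. a ^ (3 ^ j) * (inverse x ^ (3 ^ i) * x ^ (3 ^ j)))"
    unfolding abs_trace_def sum_product power_mult_distrib
    by (subst sum.swap, intro sum.cong refl, subst sum.swap) (simp add: mult_ac)
  also have "\<dots> = (\<Sum>i<n. \<Sum>j<n. a ^ (3 ^ j) * (if i = j then -1 else 0))"
    unfolding sum_distrib_left[symmetric]
    by (intro sum.cong refl arg_cong2[where f = "(*)"], subst sum_inverse_power_times_power)
       (auto simp: less simp del: One_nat_def)
  also have "\<dots> = - abs_trace n a"
    by (simp add: abs_trace_def sum_negf if_distrib cong: if_cong)
  finally show ?thesis .
qed

lemma kloosterman_trace_uminus: "kloosterman_trace n a (- x) = - kloosterman_trace n a x"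
  by (simp add: kloosterman_trace_def flip: abs_trace_uminus)

text \<open>
  On the prime field \<open>{0, 1, 2}\<close>, the indicator of \<open>1\<close> is the polynomial \<open>- (t ^ 2 + t)\<close>. So the
  count is a sum of values of this polynomial in the field: the linear part vanishes
  by \<open>x \<mapsto> - x\<close>, and after expanding the square of the trace of \<open>inverse x + a * x\<close> only the mixed
  term remains.
\<close>

lemma of_nat_trace_one_count:
  assumes "n > 1" "CARD('a::finite_field) = 3 ^ n" "a \<noteq> 0"
  shows "of_nat (trace_one_count n a) = - abs_trace n (a::'a)"
proof -
  let ?T = "kloosterman_trace n a" and ?U = "\<lambda>x. abs_trace n (inverse x)"
    and ?V = "\<lambda>x. abs_trace n (a * x)"
  have char: "CHAR('a) = 3"
    by (rule CHAR_eq_3) fact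
  note two = two_eq_minus_one[OF char]
  have ind: "of_bool (t = 1) = - (t ^ 2 + t)" if "t \<in> {0, 1, 2}" for t :: 'a
    using that by (auto simp: two)
  have "of_nat (trace_one_count n a) = (\<Sum>x\<in>UNIV. of_bool (?T x = 1) :: 'a)"
    by (simp add: trace_one_count_def)
  also have "\<dots> = (\<Sum>x\<in>UNIV. - (?T x ^ 2 + ?T x))"
    by (intro sum.cong refl ind) (use abs_trace_cases assms in \<open>auto simp: kloosterman_trace_def\<close>)
  also have "\<dots> = - ((\<Sum>x\<in>UNIV. ?T x ^ 2) + (\<Sum>x\<in>UNIV. ?T x))"
    by (simp only: sum_negf sum.distrib)
  also have "(\<Sum>x\<in>UNIV. ?T x) = 0"
  proof -
    have "(\<Sum>x\<in>UNIV. ?T x) = (\<Sum>x\<in>UNIV. ?T (- x))"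
      by (rule sum.reindex_bij_witness[of _ uminus uminus]) auto
    then have "2 * (\<Sum>x\<in>UNIV. ?T x) = 0"
      by (simp add: kloosterman_trace_uminus sum_negf)
    then show ?thesis
      unfolding two by simp
  qed
  also have "(\<Sum>x\<in>UNIV. ?T x ^ 2) =
      (\<Sum>x\<in>UNIV. ?U x ^ 2) + (\<Sum>x\<in>UNIV. ?V x ^ 2) + 2 * (\<Sum>x\<in>UNIV. ?U x * ?V x)"
    by (simp add: kloosterman_trace_def abs_trace_add[OF char] power2_sum sum.distrib
        sum_distrib_left mult.assoc)
  also have "(\<Sum>x\<in>UNIV. ?U x ^ 2) = (\<Sum>x\<in>UNIV. abs_trace n (x::'a) ^ 2)"
    by (rule sum.reindex_bij_witness[of _ inverse inverse]) auto
  also have "(\<Sum>x\<in>UNIV. ?V x ^ 2) = (\<Sum>x\<in>UNIV. abs_trace n (x::'a) ^ 2)"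
    by (rule sum.reindex_bij_witness[of _ "\<lambda>x. x / a" "\<lambda>x. a * x"]) (use assms in auto)
  finally show ?thesis
    unfolding two sum_abs_trace_squared[OF assms(1,2)]
      sum_abs_trace_inverse_times_abs_trace[OF assms(1,2)] by simp
qed

text \<open>
  The involution \<open>x \<mapsto> inverse (a * x)\<close> swaps the two summands of \<open>inverse x + a * x\<close>, so it acts on
  the counted set. Its fixed points satisfy \<open>a * x ^ 2 = 1\<close>, apart from \<open>0\<close>, where the trace is \<open>0\<close>.
\<close>

lemma even_trace_one_count_iff_card_fixpoints:
  assumes "a \<noteq> 0"
  shows "even (trace_one_count n a) \<longleftrightarrow>
    even (card {x. kloosterman_trace n a x = 1 \<and> a * x ^ 2 = 1})"
proof -
  let ?h = "\<lambda>x. inverse (a * x)"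
  have fixpoint: "?h x = x \<longleftrightarrow> x = 0 \<or> a * x ^ 2 = 1" for x
  proof (cases "x = 0")
    case False
    then have "?h x = x \<longleftrightarrow> a * x * x = 1"
      using assms by (metis inverse_unique mult_eq_0_iff right_inverse)
    then show ?thesis
      using False by (simp only: power2_eq_square mult.assoc simp_thms)
  qed simp
  have T0: "kloosterman_trace n a 0 = 0"
    by (simp add: kloosterman_trace_def abs_trace_def power_0_left)
  have swap: "kloosterman_trace n a (?h x) = kloosterman_trace n a x" for x
  proof -
    have "inverse (?h x) + a * ?h x = inverse x + a * x"
      using assms by (simp add: add.commute)
    then show ?thesis
      unfolding kloosterman_trace_def by (rule arg_cong)
  qed
  have "even (trace_one_count n a) \<longleftrightarrow> even (card {x\<in>{x. kloosterman_trace n a x = 1}. ?h x = x})"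
    unfolding trace_one_count_def
    by (rule even_card_iff_even_card_fixpoints) (use assms swap in simp_all)
  also have "{x\<in>{x. kloosterman_trace n a x = 1}. ?h x = x} =
      {x. kloosterman_trace n a x = 1 \<and> a * x ^ 2 = 1}"
    unfolding fixpoint using T0 by auto
  finally show ?thesis .
qed

text \<open>
  If \<open>a = b ^ 2\<close>, the fixed points are \<open>inverse b\<close> and \<open>- inverse b\<close>, and the exponents there have
  the traces of \<open>2 * b = - b\<close> and \<open>b\<close>. Exactly one of these is \<open>1\<close>, unless \<open>b\<close> has trace \<open>0\<close>.
\<close>

lemma odd_trace_one_count_iff:
  assumes "CARD('a::finite_field) = 3 ^ n" "(a::'a) \<noteq> 0"
  shows "odd (trace_one_count n a) \<longleftrightarrow> condition_E n a"
proof -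
  let ?F = "{x. kloosterman_trace n a x = 1 \<and> a * x ^ 2 = 1}"
  have char: "CHAR('a) = 3"
    by (rule CHAR_eq_3) fact
  note two = two_eq_minus_one[OF char]
  show ?thesis
  proof (cases "\<exists>b. b ^ 2 = a")
    case False
    have "a * x ^ 2 \<noteq> 1" for x
    proof
      assume "a * x ^ 2 = 1"
      then have "inverse x ^ 2 = a"
        by (metis inverse_unique mult.commute power_inverse)
      then show False
        using False by blast
    qed
    then have F: "?F = {}"
      by simp
    have "even (trace_one_count n a)"
      unfolding even_trace_one_count_iff_card_fixpoints[OF assms(2)] F by simp
    then show ?thesis
      using False by (auto simp: condition_E_def)
  next
    case True
    then obtain b where b: "b ^ 2 = a"
      by blast
    with assms(2) have "b \<noteq> 0"
      by auto
    have fixpoint: "a * x ^ 2 = 1 \<longleftrightarrow> x = inverse b \<or> x = - inverse b" for x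
    proof -
      have "a * x ^ 2 = 1 \<longleftrightarrow> (b * x) ^ 2 = 1"
        by (simp add: b power_mult_distrib)
      also have "\<dots> \<longleftrightarrow> b * x = 1 \<or> b * x = - 1"
        by (rule power2_eq_1_iff)
      also have "\<dots> \<longleftrightarrow> x = inverse b \<or> x = - inverse b"
        using \<open>b \<noteq> 0\<close> by (auto simp: field_simps)
      finally show ?thesis .
    qed
    have T: "kloosterman_trace n a (inverse b) = - abs_trace n b"
    proof -
      have "inverse (inverse b) + a * inverse b = 2 * b"
        using \<open>b \<noteq> 0\<close> by (simp add: power2_eq_square flip: b)
      then show ?thesis
        by (simp add: kloosterman_trace_def two abs_trace_uminus)
    qed
    have T': "kloosterman_trace n a (- inverse b) = abs_trace n b"
      by (simp add: T kloosterman_trace_uminus)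
    have neq: "inverse b \<noteq> - inverse b"
    proof
      assume "inverse b = - inverse b"
      then have "2 * inverse b = 0"
        by (simp add: eq_neg_iff_add_eq_0)
      then show False
        using \<open>b \<noteq> 0\<close> by (simp add: two)
    qed
    have neq1: "(1::'a) \<noteq> - 1"
      using neq \<open>b \<noteq> 0\<close> by (metis mult_minus_right mult_1_right)
    have F: "?F = {x. x = inverse b \<and> - abs_trace n b = 1 \<or> x = - inverse b \<and> abs_trace n b = 1}"
      unfolding fixpoint using T T' by auto
    have "abs_trace n b \<in> {0, 1, - 1}"
      using abs_trace_cases[OF assms(1), of b] unfolding two .
    then consider "abs_trace n b = 0" | "abs_trace n b = 1" | "abs_trace n b = - 1"
      by blast
    then have "odd (card ?F) \<longleftrightarrow> abs_trace n b \<noteq> 0"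
      unfolding F by cases (use neq1 in auto)
    moreover have "condition_E n a \<longleftrightarrow> abs_trace n b \<noteq> 0"
      unfolding condition_E_def using b abs_trace_eq_0_cong_square by metis
    ultimately show ?thesis
      using even_trace_one_count_iff_card_fixpoints[OF assms(2), of n] by simp
  qed
qed

lemma not_condition_E_if_condition_O:
  assumes "condition_O n a"
  shows "\<not> condition_E n a"
  using assms abs_trace_eq_0_cong_square
  unfolding condition_O_def condition_E_def is_nth_power_def by metis

section \<open>The value of the Kloosterman sum\<close>

lemma primitive_cube_root_sum:
  assumes "primitive_cube_root \<zeta>"
  shows "\<zeta> + \<zeta> ^ 2 = - 1"
proof -
  have "(\<zeta> - 1) * (\<zeta> + \<zeta> ^ 2 + 1) = \<zeta> ^ 3 - 1"
    by (simp add: algebra_simps power2_eq_square power3_eq_cube)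
  moreover have "\<zeta> ^ 3 = 1" "\<zeta> ^ 1 \<noteq> 1"
    using assms by (auto simp: primitive_cube_root_def)
  ultimately show ?thesis
    by (simp add: eq_neg_iff_add_eq_0)
qed

text \<open>
  Since the exponent is odd in \<open>x\<close>, the traces \<open>1\<close> and \<open>2\<close> are equally frequent. Each pair of
  points with these traces contributes \<open>\<zeta> + \<zeta> ^ 2 = - 1\<close> in place of \<open>2\<close>, which lowers
  the trivial value \<open>3 ^ n\<close> of the sum by \<open>3\<close>.
\<close>

lemma kloosterman_sum_eq:
  assumes "n > 0" "CARD('a::finite_field) = 3 ^ n" "primitive_cube_root \<zeta>"
  shows "kloosterman_sum n \<zeta> (a::'a) = of_int (3 ^ n - 3 * int (trace_one_count n a))"
proof -
  let ?T = "kloosterman_trace n a"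
  have char: "CHAR('a) = 3"
    by (rule CHAR_eq_3) fact
  note two = two_eq_minus_one[OF char]
  have neq: "(1::'a) \<noteq> - 1"
    by (metis two one_neq_zero add_cancel_left_left one_add_one)
  have rep: "F3_rep (0::'a) = 0" "F3_rep (1::'a) = 1" "F3_rep (2::'a) = 2"
    using F3_rep_of_nat[OF char, of 0] F3_rep_of_nat[OF char, of 1] F3_rep_of_nat[OF char, of 2]
    by auto
  have val: "\<zeta> ^ F3_rep t = 1 - (1 - \<zeta>) * of_bool (t = 1) - (1 - \<zeta> ^ 2) * of_bool (t = 2)"
    if "t \<in> {0, 1, 2}" for t :: 'a
    using that rep neq unfolding two by auto
  have "CARD('a) > 2"
    using assms self_le_power[of "3::nat" n] by simp
  then have "x ^ (3 ^ n - 2) = inverse x" for x :: 'a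
    using inverse_eq_power[of x] assms by simp
  then have "kloosterman_sum n \<zeta> a = (\<Sum>x\<in>UNIV. \<zeta> ^ F3_rep (?T x))"
    by (simp add: kloosterman_sum_def kloosterman_trace_def)
  also have "\<dots> = (\<Sum>x\<in>UNIV. 1 - (1 - \<zeta>) * of_bool (?T x = 1) - (1 - \<zeta> ^ 2) * of_bool (?T x = 2))"
    by (intro sum.cong refl val) (use abs_trace_cases assms in \<open>auto simp: kloosterman_trace_def\<close>)
  also have "\<dots> = of_nat (CARD('a)) - (1 - \<zeta>) * of_nat (card {x. ?T x = 1})
      - (1 - \<zeta> ^ 2) * of_nat (card {x. ?T x = 2})"
    by (simp add: sum_subtractf flip: sum_distrib_left)
  also have "card {x. ?T x = 2} = card {x. ?T x = 1}"
    by (rule bij_betw_same_card[of uminus], rule bij_betwI[of _ _ _ uminus])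
       (auto simp: kloosterman_trace_uminus two)
  also have "of_nat (CARD('a)) - (1 - \<zeta>) * of_nat (card {x. ?T x = 1})
      - (1 - \<zeta> ^ 2) * of_nat (card {x. ?T x = 1}) =
      3 ^ n - (2 - (\<zeta> + \<zeta> ^ 2)) * of_nat (trace_one_count n a)"
    by (simp add: assms trace_one_count_def algebra_simps)
  finally show ?thesis
    by (simp add: primitive_cube_root_sum[OF assms(3)])
qed

theorem corollary11:
  fixes n :: nat and a :: "'a::finite_field" and \<zeta> :: complex
  assumes "n > 1" and "CARD('a) = 3 ^ n"
    and "primitive_cube_root \<zeta>"
    and "a \<noteq> 0"
  shows "\<exists>K::int. kloosterman_sum n \<zeta> a = of_int K \<and>
    (abs_trace n a = 0 \<and> condition_E n a \<longrightarrow> [K = 0] (mod 18)) \<and>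
    (abs_trace n a = 1 \<and> condition_O n a \<longrightarrow> [K = 3] (mod 18)) \<and>
    (abs_trace n a = 2 \<and> condition_E n a \<longrightarrow> [K = 6] (mod 18)) \<and>
    (abs_trace n a = 0 \<and> condition_O n a \<longrightarrow> [K = 9] (mod 18)) \<and>
    (abs_trace n a = 1 \<and> condition_E n a \<longrightarrow> [K = 12] (mod 18)) \<and>
    (abs_trace n a = 2 \<and> condition_O n a \<longrightarrow> [K = 15] (mod 18))"
proof -
  define N where "N = trace_one_count n a"
  define K where "K = 3 ^ n - 3 * int N"
  have char: "CHAR('a) = 3"
    by (rule CHAR_eq_3) fact
  have K: "kloosterman_sum n \<zeta> a = of_int K"
    using kloosterman_sum_eq[of n \<zeta> a] assms by (simp add: K_def N_def)
  have even: "even K \<longleftrightarrow> condition_E n a"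
    using odd_trace_one_count_iff[OF assms(2,4)] by (simp add: K_def N_def)
  have odd: "odd K" if "condition_O n a"
    using that even not_condition_E_if_condition_O by blast
  have mod3: "3 dvd N + t" if "abs_trace n a = of_nat t" for t
  proof -
    have "of_nat (N + t) = (0::'a)"
      using of_nat_trace_one_count[OF assms(1,2,4)] that by (simp add: N_def)
    then show ?thesis
      by (metis of_nat_eq_0_iff_char_dvd char)
  qed
  obtain m where m: "(3::int) ^ n = 9 * m"
    using le_imp_power_dvd[of 2 n "3::int"] assms(1) by (auto elim!: dvdE)
  have mod9: "[K = 3 * int t] (mod 9)" if t: "abs_trace n a = of_nat t" for t
  proof -
    obtain u where "N + t = 3 * u"
      using mod3[OF t] by (elim dvdE)
    then have "int N = 3 * int u - int t"
      by linarith
    then have "K - 3 * int t = 9 * (m - int u)"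
      by (simp add: K_def m)
    then show ?thesis
      by (simp add: cong_iff_dvd_diff)
  qed
  have mod18: "[K = r] (mod 18)" if "[K = r] (mod 9)" "even K \<longleftrightarrow> even r" for r
  proof -
    have "coprime (9::int) 2"
      by (simp add: coprime_iff_gcd_eq_1 gcd_non_0_int)
    moreover have "[K = r] (mod 2)"
      using that(2) by (auto simp: cong_iff_dvd_diff)
    ultimately show ?thesis
      using coprime_cong_mult[of K r 9 2] that(1) by simp
  qed
  show ?thesis
    using K mod9[of 0] mod9[of 1] mod9[of 2] even odd
    by (intro exI[of _ K] conjI impI mod18) (auto simp: cong_def)
qed

end
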